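(* Let $D\subset\mathbb{R}^n$ be an open and convex set, let $S\subset D$ be a simplex with vertices $v_0,\dots,v_n$ and barycenter $\mathbf{b}$, and let $c>0$. If $f:D\to\mathbb{R}$ is strongly W-convex with modulus $c$, then \[ f(\mathbf{b}) +c \biggl( \frac{1}{|S|} \int_S \|x\|^2\,\mathrm{d}x -\|\mathbf{b}\|^2 \biggr) \leq \frac{1}{(n+1)|S|} \int_S \biggl( \sum_{\sigma \in C}f_{\sigma}(x) \biggr)\mathrm{d}x \leq \frac{1}{n+1} \sum_{i=0}^nf(v_i)+c \biggl( \frac{1}{|S|} \int_S \|x\|^2\,\mathrm{d}x-\frac{1}{n+1}\sum_{i=0}^n \|v_i\|^2 \biggr). \]
   Context: For a convex set $D\subset\mathbb{R}^n$ and $c>0$, a function $f:D\to\mathbb{R}$ is strongly W-convex with modulus $c$ if $f(tx+(1-t)y)+f((1-t)x+ty)\le f(x)+f(y)-2ct(1-t)\|x-y\|^2$ for all $x,y\in D$ and $t\in[0,1]$, where $\|\cdot\|$ is the Euclidean norm. A simplex with vertices $v_0,\dots,v_n\in\mathbb{R}^n$ is $S=\mathrm{conv}\{v_0,\dots,v_n\}$ where $v_0,\dots,v_n$ are affinely independent; $|S|$ denotes its volume and $\mathbf{b}=\frac{1}{n+1}\sum_{i=0}^n v_i$ its barycenter. $C$ is the set of all cyclic permutations of $\{0,\dots,n\}$, i.e. the $n+1$ shifts $i\mapsto i+k \pmod{n+1}$, $k=0,\dots,n$. Every $x\in\mathbb{R}^n$ is uniquely $x=\sum_{i=0}^n t_iv_i$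 with real $t_i$ summing to $1$, and each $\sigma\in C$ is identified with the affine map $\sigma:\mathbb{R}^n\to\mathbb{R}^n$, $\sigma\bigl(\sum_{i=0}^n t_iv_i\bigr)=\sum_{i=0}^n t_{\sigma(i)}v_i$ (which maps $S$ to $S$). For a real function $f$ defined on $S$ (or on a set containing $S$), $f_\sigma:S\to\mathbb{R}$ is defined by $f_\sigma(x)=f(\sigma(x))$. *)

theory Defs
  imports "HOL-Analysis.Analysis"
begin

text \<open>A function on \<open>D\<close> is a total function of which only the values on \<open>D\<close> matter.\<close>

definition strongly_W_convex_on :: "'a::euclidean_space set \<Rightarrow> real \<Rightarrow> ('a \<Rightarrow> real) \<Rightarrow> bool" where
  "strongly_W_convex_on D c f \<longleftrightarrow>
     (\<forall>x\<in>D. \<forall>y\<in>D. \<forall>t\<in>{0..1}.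
        f (t *\<^sub>R x + (1 - t) *\<^sub>R y) + f ((1 - t) *\<^sub>R x + t *\<^sub>R y)
          \<le> f x + f y - 2 * c * t * (1 - t) * (norm (x - y))\<^sup>2)"

text \<open>Injectivity is needed because \<^const>\<open>affine_dependent\<close> speaks about the set of
  vertices and does not see repetitions in the family.\<close>

definition simplex_with_vertices :: "nat \<Rightarrow> (nat \<Rightarrow> 'a::euclidean_space) \<Rightarrow> 'a set \<Rightarrow> bool" where
  "simplex_with_vertices n v S \<longleftrightarrow>
     inj_on v {0..n} \<and> \<not> affine_dependent (v ` {0..n}) \<and> S = convex hull (v ` {0..n})"

definition barycenter :: "nat \<Rightarrow> (nat \<Rightarrow> 'a::euclidean_space) \<Rightarrow> 'a" where
  "barycenter n v = (1 / real (n + 1)) *\<^sub>R (\<Sum>i=0..n. v i)"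

text \<open>The shifts are only ever applied to indices in \<open>{0..n}\<close>.  Their values at 0 are distinct,
  so this set has exactly \<open>n + 1\<close> elements.\<close>

definition cyclic_perms :: "nat \<Rightarrow> (nat \<Rightarrow> nat) set" where
  "cyclic_perms n = (\<lambda>k i. (i + k) mod (n + 1)) ` {0..n}"

text \<open>Barycentric coordinates with respect to \<open>v 0, \<dots>, v n\<close>.  They are set to 0 beyond
  index \<open>n\<close>, so that affine independence makes the coordinate function unique.\<close>

definition bary_coords :: "nat \<Rightarrow> (nat \<Rightarrow> 'a::euclidean_space) \<Rightarrow> 'a \<Rightarrow> nat \<Rightarrow> real" where
  "bary_coords n v x =
     (THE t. (\<forall>i>n. t i = 0) \<and> (\<Sum>i=0..n. t i) = 1 \<and> (\<Sum>i=0..n. t i *\<^sub>R v i) = x)"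

definition vertex_perm_map ::
    "nat \<Rightarrow> (nat \<Rightarrow> 'a::euclidean_space) \<Rightarrow> (nat \<Rightarrow> nat) \<Rightarrow> 'a \<Rightarrow> 'a" where
  "vertex_perm_map n v \<sigma> x = (\<Sum>i=0..n. bary_coords n v x (\<sigma> i) *\<^sub>R v i)"

lemma bary_coords_sum:
  assumes "inj_on v {0..n}" "\<not> affine_dependent (v ` {0..n})"
    and t: "(\<Sum>i=0..n. t i) = 1" and "j \<le> n"
  shows "bary_coords n v (\<Sum>i=0..n. t i *\<^sub>R v i) j = t j"
proof -
  define x where "x = (\<Sum>i=0..n. t i *\<^sub>R v i)"
  define t' where "t' = (\<lambda>i. if i \<le> n then t i else 0)"
  have "bary_coords n v x = t'"
    unfolding bary_coords_def
  proof (rule the_equality, goal_cases)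
    case 1
    then show ?case using t by (simp add: t'_def x_def)
  next
    case (2 s)
    define d where "d = (\<lambda>y. (s - t) (the_inv_into {0..n} v y))"
    have d: "d (v i) = s i - t i" if "i \<le> n" for i
      using that by (simp add: d_def the_inv_into_f_f[OF assms(1)])
    have "sum d (v ` {0..n}) = 0"
      using 2 t by (simp add: sum.reindex[OF assms(1)] d sum_subtractf)
    moreover have "(\<Sum>y\<in>v ` {0..n}. d y *\<^sub>R y) = 0"
      using 2 by (simp add: sum.reindex[OF assms(1)] d sum_subtractf scaleR_diff_left x_def)
    ultimately have "\<forall>y\<in>v ` {0..n}. d y = 0"
      using assms(2) by (auto simp: affine_dependent_explicit_finite)
    then have "s i = t i" if "i \<le> n" for i
      using d[OF that] that by force
    then show ?case using 2 by (auto simp: t'_def not_le)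
  qed
  then show ?thesis using \<open>j \<le> n\<close> by (simp add: x_def t'_def)
qed

lemma vertex_perm_map_sum:
  assumes "inj_on v {0..n}" "\<not> affine_dependent (v ` {0..n})" "(\<Sum>i=0..n. t i) = 1"
    and "\<sigma> \<in> cyclic_perms n"
  shows "vertex_perm_map n v \<sigma> (\<Sum>i=0..n. t i *\<^sub>R v i) = (\<Sum>i=0..n. t (\<sigma> i) *\<^sub>R v i)"
proof -
  have "\<sigma> i \<le> n" for i
    using assms(4) mod_less_divisor[of "n + 1"] by (auto simp: cyclic_perms_def less_Suc_eq_le)
  then show ?thesis
    by (simp add: vertex_perm_map_def bary_coords_sum[OF assms(1-3)])
qed

end

theory Submission
  imports Defs
begin

text \<open>
  By the parallelogram-type identity for the Euclidean norm, \<open>g = f - c \<parallel>\<cdot>\<parallel>\<^sup>2\<close> is Wright convex, that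
  is, strongly W-convex with modulus 0
  (\<open>strongly_W_convex_on_iff_minus_square\<close>).  On an open convex set, a Wright-convex function
  is the sum of a convex function and an additive one, and the additive summand need not be measurable.
  Summing over the cyclic shifts removes it: for \<open>\<sigma>\<close> in the set \<open>C\<close> of
  these shifts, the points \<open>\<sigma> x\<close> have the barycenter \<open>b\<close> as their mean, so the additive summand
  contributes only a constant to \<open>G x = (\<Sum>\<sigma>\<in>C. g (\<sigma> x))\<close>, and \<open>G\<close> is convex.

  That \<open>G\<close> is convex can be seen without the decomposition.  Midpoint
  convexity of \<open>g\<close> gives \<open>G x \<ge> (n + 1) g b\<close>, so \<open>G\<close> is bounded below.  The two terms
  on the left of the defining inequality of Wright convexity are then each bounded above, so \<open>G\<close> is
  bounded above on every segment, and a midpoint-convex function with this property is convex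
  (\<open>Wright_convex_on_bounded_below_imp_convex_on\<close>).  Being convex on an open set that
  contains \<open>S\<close>, the function \<open>G\<close> is continuous on \<open>S\<close>; and as \<open>G (v j) = (\<Sum>i. g (v i))\<close> at every
  vertex, it satisfies
  \<open>(n + 1) g b \<le> G x \<le> (\<Sum>i. g (v i))\<close> on \<open>S\<close> (\<open>cyclic_symmetrization_Wright_convex\<close>).

  Integrating these bounds over \<open>S\<close> gives the theorem, once \<open>\<integral>\<^sub>S \<parallel>\<sigma> x\<parallel>\<^sup>2 dx = \<integral>\<^sub>S \<parallel>x\<parallel>\<^sup>2 dx\<close> is known.
  This holds because an affine bijection that maps a set of finite positive measure onto itself
  preserves Lebesgue measure (\<open>distr_lborel_eq_if_fixes_set\<close>).
\<close>

section \<open>Wright-convex functions\<close>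

text \<open>The two convex combinations of \<open>x\<close> and \<open>y\<close> have squared norms adding up to
  \<open>\<parallel>x\<parallel>\<^sup>2 + \<parallel>y\<parallel>\<^sup>2 - 2 t (1 - t) \<parallel>x - y\<parallel>\<^sup>2\<close>, so \<open>c \<parallel>\<cdot>\<parallel>\<^sup>2\<close> satisfies the strong inequality with equality.\<close>

lemma strongly_W_convex_on_iff_minus_square:
  "strongly_W_convex_on D c f \<longleftrightarrow> strongly_W_convex_on D 0 (\<lambda>x. f x - c * (norm x)\<^sup>2)"
proof -
  have norms: "(norm (t *\<^sub>R x + (1 - t) *\<^sub>R y))\<^sup>2 + (norm ((1 - t) *\<^sub>R x + t *\<^sub>R y))\<^sup>2
      = (norm x)\<^sup>2 + (norm y)\<^sup>2 - 2 * t * (1 - t) * (norm (x - y))\<^sup>2" for t and x y :: 'a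
    unfolding power2_norm_eq_inner
    by (simp add: inner_diff_left inner_diff_right inner_add_left inner_add_right inner_commute algebra_simps)
  have e: "c * (norm (t *\<^sub>R x + (1 - t) *\<^sub>R y))\<^sup>2 + c * (norm ((1 - t) *\<^sub>R x + t *\<^sub>R y))\<^sup>2
      = c * (norm x)\<^sup>2 + c * (norm y)\<^sup>2 - 2 * c * t * (1 - t) * (norm (x - y))\<^sup>2" for t and x y :: 'a
  proof -
    have "c * N1 + c * N2 = c * X + c * Y - 2 * c * t * (1 - t) * N"
      if "N1 + N2 = X + Y - 2 * t * (1 - t) * N" for N1 N2 X Y N :: real
    proof -
      have "c * N1 + c * N2 = c * (N1 + N2)" by (rule distrib_left[symmetric])
      also have "\<dots> = c * X + c * Y - 2 * c * t * (1 - t) * N"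
        unfolding that by (simp add: algebra_simps)
      finally show ?thesis .
    qed
    from this[OF norms] show ?thesis .
  qed
  have "(f (t *\<^sub>R x + (1 - t) *\<^sub>R y) + f ((1 - t) *\<^sub>R x + t *\<^sub>R y)
          \<le> f x + f y - 2 * c * t * (1 - t) * (norm (x - y))\<^sup>2)
      = (f (t *\<^sub>R x + (1 - t) *\<^sub>R y) - c * (norm (t *\<^sub>R x + (1 - t) *\<^sub>R y))\<^sup>2
          + (f ((1 - t) *\<^sub>R x + t *\<^sub>R y) - c * (norm ((1 - t) *\<^sub>R x + t *\<^sub>R y))\<^sup>2)
          \<le> f x - c * (norm x)\<^sup>2 + (f y - c * (norm y)\<^sup>2)
             - 2 * 0 * t * (1 - t) * (norm (x - y))\<^sup>2)" for t x y
    unfolding mult_zero_left mult_zero_right using e[of t x y] by (intro iffI; linarith)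
  then show ?thesis
    unfolding strongly_W_convex_on_def by (intro ball_cong refl)
qed

lemma Wright_convex_on_pair:
  assumes "strongly_W_convex_on D 0 g" "x \<in> D" "y \<in> D" "0 \<le> t" "t \<le> 1"
  shows "g (t *\<^sub>R x + (1 - t) *\<^sub>R y) + g ((1 - t) *\<^sub>R x + t *\<^sub>R y) \<le> g x + g y"
  using assms unfolding strongly_W_convex_on_def by force

lemma Wright_convex_on_midpoint:
  assumes "strongly_W_convex_on D 0 g" "x \<in> D" "y \<in> D"
  shows "g ((1 / 2) *\<^sub>R x + (1 / 2) *\<^sub>R y) \<le> (g x + g y) / 2"
  using Wright_convex_on_pair[OF assms, of "1/2"] by simp

text \<open>The doubling step in Cauchy's proof of Jensen's inequality for midpoint-convex functions.\<close>

lemma Wright_convex_on_mean_power_of_two: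
  fixes x :: "nat \<Rightarrow> 'a::euclidean_space"
  assumes "strongly_W_convex_on D 0 g" "convex D" "\<And>i. i < 2 ^ k \<Longrightarrow> x i \<in> D"
  shows "g ((1 / 2 ^ k) *\<^sub>R (\<Sum>i<2^k. x i)) \<le> (1 / 2 ^ k) * (\<Sum>i<2^k. g (x i))
    \<and> (1 / 2 ^ k) *\<^sub>R (\<Sum>i<2^k. x i) \<in> D"
  using assms(3)
proof (induction k arbitrary: x)
  case 0
  then show ?case by simp
next
  case (Suc k)
  have split: "(\<Sum>i<2^Suc k. h i) = (\<Sum>i<2^k. h i) + (\<Sum>i<2^k. h (2 ^ k + i))"
    for h :: "nat \<Rightarrow> 'b::comm_monoid_add"
    using sum.atLeastLessThan_concat[of 0 "2^k" "2^Suc k" h]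
      sum.shift_bounds_nat_ivl[of h 0 "2^k" "2^k"]
    by (simp add: lessThan_atLeast0 mult_2 add.commute)
  define p where "p = (1 / 2 ^ k) *\<^sub>R (\<Sum>i<2^k. x i)"
  define q where "q = (1 / 2 ^ k) *\<^sub>R (\<Sum>i<2^k. x (2 ^ k + i))"
  have p: "g p \<le> (1 / 2 ^ k) * (\<Sum>i<2^k. g (x i))" "p \<in> D"
    unfolding p_def using Suc.IH[of x] Suc.prems by auto
  have q: "g q \<le> (1 / 2 ^ k) * (\<Sum>i<2^k. g (x (2 ^ k + i)))" "q \<in> D"
    unfolding q_def using Suc.IH[of "\<lambda>i. x (2 ^ k + i)"] Suc.prems by auto
  have eq: "(1 / 2 ^ Suc k) *\<^sub>R (\<Sum>i<2^Suc k. x i) = (1 / 2) *\<^sub>R p + (1 / 2) *\<^sub>R q"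
    by (simp only: split p_def q_def) (simp add: scaleR_right_distrib)
  have "g ((1 / 2) *\<^sub>R p + (1 / 2) *\<^sub>R q) \<le> (g p + g q) / 2"
    by (rule Wright_convex_on_midpoint[OF assms(1) p(2) q(2)])
  also have "\<dots> \<le> ((1 / 2 ^ k) * (\<Sum>i<2^k. g (x i))
      + (1 / 2 ^ k) * (\<Sum>i<2^k. g (x (2 ^ k + i)))) / 2"
    by (intro divide_right_mono add_mono p(1) q(1)) simp
  also have "\<dots> = (1 / 2 ^ Suc k) * (\<Sum>i<2^Suc k. g (x i))"
    by (simp only: split) (simp add: field_simps)
  finally show ?case
    unfolding eq using convexD[OF assms(2) p(2) q(2), of "1/2" "1/2"] by simp
qed

text \<open>Padding the points with copies of their mean \<open>m\<close> up to \<open>2 ^ N\<close> points leaves the mean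
  unchanged and adds \<open>2 ^ N - N\<close> times \<open>g m\<close> to the right-hand side, which cancels.\<close>

lemma Wright_convex_on_mean:
  fixes x :: "nat \<Rightarrow> 'a::euclidean_space"
  assumes "strongly_W_convex_on D 0 g" "convex D" "\<And>i. i < N \<Longrightarrow> x i \<in> D" "0 < N"
  shows "real N * g ((1 / real N) *\<^sub>R (\<Sum>i<N. x i)) \<le> (\<Sum>i<N. g (x i))"
proof -
  define m where "m = (1 / real N) *\<^sub>R (\<Sum>i<N. x i)"
  have m: "m \<in> D"
    using convex_sum[of "{..<N}" D "\<lambda>_. 1 / real N" x] assms
    by (simp add: m_def scaleR_sum_right)
  define y where "y = (\<lambda>i. if i < N then x i else m)"
  have pad: "(\<Sum>i<2^N. h (y i)) = (\<Sum>i<N. h (x i)) + (2 ^ N - real N) *\<^sub>R h m"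
    for h :: "'a \<Rightarrow> 'b::real_vector"
  proof -
    have "{..<2^N} = {..<N} \<union> {N..<2^N}"
      using less_exp[of N] by (auto intro: less_trans)
    then have "(\<Sum>i<2^N. h (y i)) = (\<Sum>i<N. h (y i)) + (\<Sum>i=N..<2^N. h (y i))"
      by (simp add: sum.union_disjoint ivl_disj_int)
    also have "\<dots> = (\<Sum>i<N. h (x i)) + (\<Sum>i=N..<2^N. h m)"
      by (intro arg_cong2[of _ _ _ _ "(+)"] sum.cong) (auto simp: y_def)
    finally show ?thesis
      using less_exp[of N] by (simp add: sum_constant_scaleR of_nat_diff)
  qed
  have "(\<Sum>i<N. x i) = real N *\<^sub>R m"
    using assms(4) by (simp add: m_def)
  then have "(\<Sum>i<2^N. y i) = 2 ^ N *\<^sub>R m"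
    using pad[of "\<lambda>z. z"] by (simp add: scaleR_left_diff_distrib)
  moreover have "g ((1 / 2 ^ N) *\<^sub>R (\<Sum>i<2^N. y i)) \<le> (1 / 2 ^ N) * (\<Sum>i<2^N. g (y i))"
    using Wright_convex_on_mean_power_of_two[OF assms(1,2), of N y] assms(3) m
    by (auto simp: y_def)
  ultimately show ?thesis
    unfolding m_def[symmetric] using pad[of g] by (simp add: field_simps)
qed

text \<open>Additive functions that are not linear show that Wright convexity alone does not suffice.  With a
  lower bound \<open>m\<close>, each of the two values on the left of the Wright inequality is at most
  \<open>g x + g y - m\<close>, so \<open>g\<close> is bounded above on the segment from \<open>x\<close> to \<open>y\<close>.  The difference
  \<open>\<phi>\<close> between \<open>g\<close> and its chord is midpoint convex and vanishes at both ends.  Every \<open>t\<close> is the midpoint of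
  an end and another point of the segment, whence \<open>sup \<phi> \<le> sup \<phi> / 2\<close>; as the supremum is finite,
  it is not positive.\<close>

lemma Wright_convex_on_bounded_below_imp_convex_on:
  assumes W: "strongly_W_convex_on E 0 g" and E: "convex E" and below: "\<And>x. x \<in> E \<Longrightarrow> m \<le> g x"
  shows "convex_on E g"
proof (rule convex_onI[OF _ E])
  fix s x y
  assume s: "0 < s" "s < (1::real)" and x: "x \<in> E" and y: "y \<in> E"
  define p where "p = (\<lambda>t. (1 - t) *\<^sub>R x + t *\<^sub>R y)"
  define \<phi> where "\<phi> = (\<lambda>t. g (p t) - ((1 - t) * g x + t * g y))"
  have p: "p t \<in> E" if "t \<in> {0..1}" for t
    using that convexD[OF E x y, of "1 - t" t] by (auto simp: p_def)
  have above: "\<phi> t \<le> g x + g y - m + \<bar>g x\<bar> + \<bar>g y\<bar>" if t: "t \<in> {0..1}" for t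
  proof -
    have "m \<le> g (t *\<^sub>R x + (1 - t) *\<^sub>R y)"
      using p[of "1 - t"] t below by (simp add: p_def)
    then have 1: "g (p t) \<le> g x + g y - m"
      using Wright_convex_on_pair[OF W x y, of t] t by (simp add: p_def)
    have "\<bar>(1 - t) * g x\<bar> \<le> \<bar>g x\<bar>" "\<bar>t * g y\<bar> \<le> \<bar>g y\<bar>"
      using t by (auto simp: abs_mult intro!: mult_left_le_one_le)
    with 1 show ?thesis unfolding \<phi>_def by linarith
  qed
  define M where "M = (SUP t\<in>{0..1}. \<phi> t)"
  have upper: "\<phi> t \<le> M" if "t \<in> {0..1}" for t
    unfolding M_def using above by (intro cSUP_upper that bdd_aboveI2) auto
  have half: "\<phi> ((a + b) / 2) \<le> (\<phi> a + \<phi> b) / 2" if "a \<in> {0..1}" "b \<in> {0..1}" for a b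
  proof -
    have "p ((a + b) / 2) = (1 / 2) *\<^sub>R p a + (1 / 2) *\<^sub>R p b"
    proof -
      have "1 - (a + b) / 2 = (1 / 2) * (1 - a) + (1 / 2) * (1 - b)" "(a + b) / 2 = (1 / 2) * a + (1 / 2) * b"
        by (simp_all add: field_simps)
      then show ?thesis
        unfolding p_def by (simp only: scaleR_add_left scaleR_add_right scaleR_scaleR add_ac)
    qed
    then show ?thesis
      using Wright_convex_on_midpoint[OF W p[OF that(1)] p[OF that(2)]]
      by (simp add: \<phi>_def field_simps)
  qed
  have ends: "\<phi> 0 = 0" "\<phi> 1 = 0" by (simp_all add: \<phi>_def p_def)
  have "\<phi> t \<le> M / 2" if t: "t \<in> {0..1}" for t
  proof (cases "t \<le> 1 / 2")
    case True
    then show ?thesis using half[of 0 "2 * t"] upper[of "2 * t"] t ends by simp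
  next
    case False
    then show ?thesis using half[of "2 * t - 1" 1] upper[of "2 * t - 1"] t ends by simp
  qed
  then have "M \<le> M / 2" unfolding M_def by (intro cSUP_least) auto
  with upper[of s] s have "\<phi> s \<le> 0" by simp
  then show "g ((1 - s) *\<^sub>R x + s *\<^sub>R y) \<le> (1 - s) * g x + s * g y"
    by (simp add: \<phi>_def p_def)
qed

section \<open>Affine maps that preserve Lebesgue measure\<close>

lemma nn_integral_lborel_translate:
  fixes h :: "'a::euclidean_space \<Rightarrow> ennreal"
  assumes [measurable]: "h \<in> borel_measurable borel"
  shows "(\<integral>\<^sup>+x. h (a + x) \<partial>lborel) = (\<integral>\<^sup>+x. h x \<partial>lborel)"
  by (subst (2) lborel_distr_plus[of a, symmetric], subst nn_integral_distr) auto

lemma nn_integral_lborel_reflect: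
  fixes h :: "'a::euclidean_space \<Rightarrow> ennreal"
  assumes [measurable]: "h \<in> borel_measurable borel"
  shows "(\<integral>\<^sup>+x. h (a - x) \<partial>lborel) = (\<integral>\<^sup>+x. h x \<partial>lborel)"
proof -
  have "distr lborel borel (\<lambda>x. a - x) = (lborel :: 'a measure)"
    using lborel_affine[of "-1" a] by (simp add: density_1)
  then show ?thesis
    by (subst (2) \<open>_ = _\<close>[symmetric], subst nn_integral_distr) auto
qed

text \<open>This is the uniqueness argument for Haar measure.  Under the hypothesis on translations, the image
  of Lebesgue measure \<open>\<lambda>\<close> under \<open>T\<close> is translation invariant, and integrating
  \<open>1\<^sub>A (T x) 1\<^sub>B (T x + y)\<close> over \<open>x\<close> and \<open>y\<close> in both orders shows that it is proportional to \<open>\<lambda>\<close>.\<close>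

lemma emeasure_lborel_preimage_cross_multiply:
  fixes T :: "'a::euclidean_space \<Rightarrow> 'a"
  assumes T[measurable]: "T \<in> borel_measurable borel"
    and trans: "\<And>y. \<exists>z. \<forall>x. T (z + x) = T x - y"
    and A[measurable]: "A \<in> sets borel" and B[measurable]: "B \<in> sets borel"
  shows "emeasure lborel (T -` A) * emeasure lborel B = emeasure lborel A * emeasure lborel (T -` B)"
proof -
  let ?I = "indicator :: 'a set \<Rightarrow> 'a \<Rightarrow> ennreal"
  have pre: "(\<integral>\<^sup>+x. ?I C (T x) \<partial>lborel) = emeasure lborel (T -` C)" if "C \<in> sets borel" for C
    using measurable_sets[OF T that]
    by (simp add: nn_integral_indicator[symmetric] indicator_vimage[symmetric] del: nn_integral_indicator)
  have "emeasure lborel (T -` A) * emeasure lborel B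
      = (\<integral>\<^sup>+x. ?I A (T x) * (\<integral>\<^sup>+y. ?I B (T x + y) \<partial>lborel) \<partial>lborel)"
    by (simp add: nn_integral_lborel_translate nn_integral_multc pre)
  also have "\<dots> = (\<integral>\<^sup>+x. (\<integral>\<^sup>+y. ?I A (T x) * ?I B (T x + y) \<partial>lborel) \<partial>lborel)"
    by (simp add: nn_integral_cmult)
  also have "\<dots> = (\<integral>\<^sup>+y. (\<integral>\<^sup>+x. ?I A (T x) * ?I B (T x + y) \<partial>lborel) \<partial>lborel)"
    by (rule lborel_pair.Fubini'[symmetric]) measurable
  also have "\<dots> = (\<integral>\<^sup>+y. (\<integral>\<^sup>+x. ?I A (T x - y) * ?I B (T x) \<partial>lborel) \<partial>lborel)"
  proof (rule nn_integral_cong)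
    fix y
    obtain z where z: "\<And>x. T (z + x) = T x - y" using trans by blast
    show "(\<integral>\<^sup>+x. ?I A (T x) * ?I B (T x + y) \<partial>lborel) = (\<integral>\<^sup>+x. ?I A (T x - y) * ?I B (T x) \<partial>lborel)"
      by (subst nn_integral_lborel_translate[of _ z, symmetric]) (simp_all add: z)
  qed
  also have "\<dots> = (\<integral>\<^sup>+x. (\<integral>\<^sup>+y. ?I A (T x - y) * ?I B (T x) \<partial>lborel) \<partial>lborel)"
    by (rule lborel_pair.Fubini') measurable
  also have "\<dots> = emeasure lborel A * emeasure lborel (T -` B)"
    by (simp add: nn_integral_multc nn_integral_cmult nn_integral_lborel_reflect pre)
  finally show ?thesis .
qed

text \<open>The invariant set \<open>S\<close> forces the factor of proportionality to be 1.  For an affine \<open>T\<close> this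
  yields \<open>\<bar>det\<bar> = 1\<close> in every Euclidean space without choosing a matrix.\<close>

lemma distr_lborel_eq_if_fixes_set:
  fixes T :: "'a::euclidean_space \<Rightarrow> 'a"
  assumes T[measurable]: "T \<in> borel_measurable borel"
    and trans: "\<And>y. \<exists>z. \<forall>x. T (z + x) = T x - y"
    and S[measurable]: "S \<in> sets borel" and fixed: "T -` S = S"
    and "emeasure lborel S \<noteq> 0" "emeasure lborel S \<noteq> \<infinity>"
  shows "distr lborel borel T = lborel"
proof (rule measure_eqI)
  fix A assume "A \<in> sets (distr lborel borel T)"
  then have A: "A \<in> sets borel" by simp
  have "emeasure lborel (T -` A) * emeasure lborel S = emeasure lborel A * emeasure lborel S"
    using emeasure_lborel_preimage_cross_multiply[OF T trans A S] fixed by simp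
  then have "emeasure lborel (T -` A) = emeasure lborel A"
    using assms(5,6) ennreal_mult_cancel_left[of "emeasure lborel S"]
    by (metis infinity_ennreal_def mult.commute)
  then show "emeasure (distr lborel borel T) A = emeasure lborel A"
    using A by (simp add: emeasure_distr)
qed simp

definition affine_map :: "('a::real_vector \<Rightarrow> 'b::real_vector) \<Rightarrow> bool" where
  "affine_map T \<longleftrightarrow> (\<forall>x y t. T (t *\<^sub>R x + (1 - t) *\<^sub>R y) = t *\<^sub>R T x + (1 - t) *\<^sub>R T y)"

lemma affine_map_comb:
  "affine_map T \<Longrightarrow> T (t *\<^sub>R x + (1 - t) *\<^sub>R y) = t *\<^sub>R T x + (1 - t) *\<^sub>R T y"
  by (simp add: affine_map_def)

lemma affine_map_linear_part:
  assumes "affine_map T"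
  shows "linear (\<lambda>x. T x - T 0)"
proof -
  have scale: "T (r *\<^sub>R x) - T 0 = r *\<^sub>R (T x - T 0)" for r x
    using affine_map_comb[OF assms, of r x 0] by (simp add: algebra_simps)
  have "T (x + y) - T 0 = (T x - T 0) + (T y - T 0)" for x y
  proof -
    have "T (x + y) - T 0 = 2 *\<^sub>R (T ((1 / 2) *\<^sub>R x + (1 - 1 / 2) *\<^sub>R y) - T 0)"
      unfolding scale[symmetric] by (simp add: scaleR_add_right)
    also have "\<dots> = (T x - T 0) + (T y - T 0)"
      unfolding affine_map_comb[OF assms] by (simp add: scaleR_add_right scaleR_diff_right scaleR_2)
    finally show ?thesis .
  qed
  with scale show ?thesis by (intro linearI) auto
qed

lemma affine_map_continuous_on:
  fixes T :: "'a::euclidean_space \<Rightarrow> 'b::real_normed_vector"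
  assumes "affine_map T"
  shows "continuous_on A T"
proof -
  have "continuous_on A (\<lambda>x. (T x - T 0) + T 0)"
    by (intro continuous_intros linear_continuous_on_compose[OF _ affine_map_linear_part[OF assms], of _ "\<lambda>x. x"])
  then show ?thesis by simp
qed

lemma affine_map_surj_conjugates_translation:
  assumes "affine_map T" "surj T"
  shows "\<exists>z. \<forall>x. T (z + x) = T x - y"
proof -
  obtain z where z: "T z = T 0 - y" using assms(2) by (metis surjD)
  have "T (z + x) = T x - y" for x
    using linear_add[OF affine_map_linear_part[OF assms(1)], of z x] z by (simp add: algebra_simps)
  then show ?thesis by blast
qed

lemma integral_lborel_affine_invariant_set:
  fixes T :: "'a::euclidean_space \<Rightarrow> 'a" and q :: "'a \<Rightarrow> real"
  assumes T: "affine_map T" "surj T" "T -` S = S" and S: "compact S" "emeasure lborel S \<noteq> 0"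
    and q: "q \<in> borel_measurable borel"
  shows "(LINT x:S|lborel. q (T x)) = (LINT x:S|lborel. q x)"
proof -
  have T_meas: "T \<in> borel_measurable borel"
    using affine_map_continuous_on[OF T(1)] by (rule borel_measurable_continuous_onI)
  have S_meas: "S \<in> sets borel" using S(1) by (rule borel_compact)
  have "emeasure lborel S \<noteq> \<infinity>"
    using emeasure_compact_finite[OF S(1)] by auto
  then have dist: "distr lborel borel T = lborel"
    by (intro distr_lborel_eq_if_fixes_set[OF T_meas _ S_meas T(3) S(2)]
        affine_map_surj_conjugates_translation T)
  have ind: "indicator S (T x) = (indicator S x :: real)" for x
    using T(3) by (auto simp: indicator_def)
  have "(LINT x:S|lborel. q x) = (\<integral>x. indicator S x *\<^sub>R q x \<partial>distr lborel borel T)"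
    by (simp add: dist set_lebesgue_integral_def)
  also have "\<dots> = (\<integral>x. indicator S (T x) *\<^sub>R q (T x) \<partial>lborel)"
    using T_meas S_meas q by (intro integral_distr) (auto intro!: borel_measurable_scaleR)
  finally show ?thesis by (simp add: ind set_lebesgue_integral_def)
qed

section \<open>Cyclic shifts of the indices\<close>

lemma sum_over_cyclic_perms:
  "(\<Sum>\<sigma>\<in>cyclic_perms n. h \<sigma>) = (\<Sum>k=0..n. h (\<lambda>i. (i + k) mod (n + 1)))"
proof -
  have "inj_on (\<lambda>k i. (i + k) mod (n + 1)) {0..n}"
  proof (rule inj_onI)
    fix k l assume kl: "k \<in> {0..n}" "l \<in> {0..n}"
      and "(\<lambda>i. (i + k) mod (n + 1)) = (\<lambda>i. (i + l) mod (n + 1))"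
    from fun_cong[OF this(3), of 0] kl show "k = l" by simp
  qed
  then show ?thesis unfolding cyclic_perms_def by (simp add: sum.reindex)
qed

lemma cyclic_shift_inverse:
  fixes n k i :: nat
  assumes "k \<le> n" "i \<le> n"
  shows "((i + k) mod (n + 1) + (n + 1 - k)) mod (n + 1) = i"
    and "((i + (n + 1 - k)) mod (n + 1) + k) mod (n + 1) = i"
proof -
  have "i + k + (n + 1 - k) = i + (n + 1)" "i + (n + 1 - k) + k = i + (n + 1)"
    using assms(1) by simp_all
  moreover have "(i + (n + 1)) mod (n + 1) = i"
    using assms(2) by (simp only: mod_add_self2) simp
  ultimately show "((i + k) mod (n + 1) + (n + 1 - k)) mod (n + 1) = i"
    "((i + (n + 1 - k)) mod (n + 1) + k) mod (n + 1) = i"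
    by (simp_all only: mod_add_left_eq)
qed

lemma bij_betw_cyclic_shift:
  fixes n k :: nat
  assumes "k \<le> n"
  shows "bij_betw (\<lambda>i. (i + k) mod (n + 1)) {0..n} {0..n}"
proof (rule bij_betw_byWitness[where f' = "\<lambda>i. (i + (n + 1 - k)) mod (n + 1)"])
  show "\<forall>i\<in>{0..n}. ((i + k) mod (n + 1) + (n + 1 - k)) mod (n + 1) = i"
    "\<forall>i\<in>{0..n}. ((i + (n + 1 - k)) mod (n + 1) + k) mod (n + 1) = i"
    by (intro ballI cyclic_shift_inverse[OF assms]; simp)+
  show "(\<lambda>i. (i + k) mod (n + 1)) ` {0..n} \<subseteq> {0..n}"
    "(\<lambda>i. (i + (n + 1 - k)) mod (n + 1)) ` {0..n} \<subseteq> {0..n}"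
    using mod_less_divisor[of "n + 1"] by (auto simp: less_Suc_eq_le)
qed

lemma bij_betw_cyclic_perm:
  "\<sigma> \<in> cyclic_perms n \<Longrightarrow> bij_betw \<sigma> {0..n} {0..n}"
  using bij_betw_cyclic_shift unfolding cyclic_perms_def by fastforce

text \<open>The shifts act simply transitively on \<open>{0..n}\<close>.\<close>

lemma sum_cyclic_perms_orbit:
  assumes "i \<le> n"
  shows "(\<Sum>\<sigma>\<in>cyclic_perms n. h (\<sigma> i)) = (\<Sum>j=0..n. h j)"
  using sum.reindex_bij_betw[OF bij_betw_cyclic_shift[OF assms], of h]
  by (simp add: sum_over_cyclic_perms add.commute)

section \<open>Barycentric coordinates and permutations of the vertices\<close>

context
  fixes n :: nat and v :: "nat \<Rightarrow> 'a::euclidean_space"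
  assumes inj: "inj_on v {0..n}" and indep: "\<not> affine_dependent (v ` {0..n})"
    and dim: "n = DIM('a)"
begin

lemma bary_coords_eqI:
  assumes "(\<Sum>i=0..n. t i) = 1" "(\<Sum>i=0..n. t i *\<^sub>R v i) = x" "j \<le> n"
  shows "bary_coords n v x j = t j"
  using bary_coords_sum[OF inj indep assms(1,3)] assms(2) by simp

lemma bary_coords_represent:
  shows sum_bary_coords: "(\<Sum>i=0..n. bary_coords n v x i) = 1"
    and bary_coords_combination: "(\<Sum>i=0..n. bary_coords n v x i *\<^sub>R v i) = x"
proof -
  have "affine hull (v ` {0..n}) = UNIV"
    using indep dim card_image[OF inj] by (intro affine_independent_span_eq) auto
  then obtain u where "sum u (v ` {0..n}) = 1" "(\<Sum>y\<in>v ` {0..n}. u y *\<^sub>R y) = x"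
    using affine_hull_finite[of "v ` {0..n}"] by auto
  then have u: "(\<Sum>i=0..n. u (v i)) = 1" "(\<Sum>i=0..n. u (v i) *\<^sub>R v i) = x"
    by (simp_all add: sum.reindex[OF inj])
  have c: "bary_coords n v x i = u (v i)" if "i \<in> {0..n}" for i
    using bary_coords_eqI[of "\<lambda>i. u (v i)" x i] u that by simp
  show "(\<Sum>i=0..n. bary_coords n v x i) = 1" "(\<Sum>i=0..n. bary_coords n v x i *\<^sub>R v i) = x"
    using u by (simp_all add: c)
qed

lemma bary_coords_affine:
  assumes "j \<le> n"
  shows "bary_coords n v (t *\<^sub>R x + (1 - t) *\<^sub>R y) j
    = t * bary_coords n v x j + (1 - t) * bary_coords n v y j"
proof (rule bary_coords_eqI[OF _ _ assms])
  let ?b = "bary_coords n v"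
  show "(\<Sum>i=0..n. t * ?b x i + (1 - t) * ?b y i) = 1"
    by (simp add: sum.distrib sum_distrib_left[symmetric] sum_bary_coords)
  have "(\<Sum>i=0..n. (t * ?b x i + (1 - t) * ?b y i) *\<^sub>R v i)
      = t *\<^sub>R (\<Sum>i=0..n. ?b x i *\<^sub>R v i) + (1 - t) *\<^sub>R (\<Sum>i=0..n. ?b y i *\<^sub>R v i)"
    by (simp only: scaleR_sum_right scaleR_scaleR scaleR_add_left sum.distrib)
  then show "(\<Sum>i=0..n. (t * ?b x i + (1 - t) * ?b y i) *\<^sub>R v i) = t *\<^sub>R x + (1 - t) *\<^sub>R y"
    by (simp only: bary_coords_combination)
qed

lemma mem_simplex_iff_bary_coords:
  "x \<in> convex hull (v ` {0..n}) \<longleftrightarrow> (\<forall>i\<le>n. 0 \<le> bary_coords n v x i)"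
proof
  assume "x \<in> convex hull (v ` {0..n})"
  then obtain u where u: "\<forall>y\<in>v ` {0..n}. 0 \<le> u y"
    "sum u (v ` {0..n}) = 1" "(\<Sum>y\<in>v ` {0..n}. u y *\<^sub>R y) = x"
    unfolding convex_hull_finite[OF finite_imageI[OF finite_atLeastAtMost]] by blast
  then have "bary_coords n v x i = u (v i)" if "i \<le> n" for i
    using bary_coords_eqI[of "\<lambda>i. u (v i)" x i] that by (simp add: sum.reindex[OF inj])
  with u(1) show "\<forall>i\<le>n. 0 \<le> bary_coords n v x i" by simp
next
  assume "\<forall>i\<le>n. 0 \<le> bary_coords n v x i"
  then have "(\<Sum>i=0..n. bary_coords n v x i *\<^sub>R v i) \<in> convex hull (v ` {0..n})"
    by (intro convex_sum convex_convex_hull sum_bary_coords) (auto intro: hull_inc)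
  then show "x \<in> convex hull (v ` {0..n})" by (simp add: bary_coords_combination)
qed

lemma affine_map_vertex_perm_map:
  assumes "\<sigma> ` {0..n} \<subseteq> {0..n}"
  shows "affine_map (vertex_perm_map n v \<sigma>)"
proof -
  have "\<sigma> i \<le> n" if "i \<in> {0..n}" for i using assms that by force
  then show ?thesis
    unfolding affine_map_def vertex_perm_map_def
    by (auto simp: bary_coords_affine scaleR_add_left scaleR_sum_right sum.distrib)
qed

lemma bary_coords_vertex_perm_map:
  assumes \<sigma>: "bij_betw \<sigma> {0..n} {0..n}" and "j \<le> n"
  shows "bary_coords n v (vertex_perm_map n v \<sigma> x) j = bary_coords n v x (\<sigma> j)"
  using sum.reindex_bij_betw[OF \<sigma>, of "bary_coords n v x"] assms(2)
  by (intro bary_coords_eqI[of "\<lambda>i. bary_coords n v x (\<sigma> i)"])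
     (simp_all add: sum_bary_coords vertex_perm_map_def)

text \<open>In barycentric coordinates the map is composition with \<open>\<sigma>\<close>, so the inverse permutation
  provides preimages.\<close>

lemma surj_vertex_perm_map:
  assumes \<sigma>: "bij_betw \<sigma> {0..n} {0..n}"
  shows "surj (vertex_perm_map n v \<sigma>)"
proof (rule surjI)
  let ?\<tau> = "the_inv_into {0..n} \<sigma>"
  have \<tau>: "bij_betw ?\<tau> {0..n} {0..n}" by (rule bij_betw_the_inv_into[OF \<sigma>])
  fix x
  have "vertex_perm_map n v \<sigma> (vertex_perm_map n v ?\<tau> x)
      = (\<Sum>i=0..n. bary_coords n v x (?\<tau> (\<sigma> i)) *\<^sub>R v i)"
    unfolding vertex_perm_map_def[of n v \<sigma>]
    using bij_betwE[OF \<sigma>]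
    by (intro sum.cong refl arg_cong2[of _ _ _ _ scaleR] bary_coords_vertex_perm_map[OF \<tau>]) auto
  also have "\<dots> = (\<Sum>i=0..n. bary_coords n v x i *\<^sub>R v i)"
    using \<sigma> by (intro sum.cong) (auto simp: the_inv_into_f_f bij_betw_def)
  finally show "vertex_perm_map n v \<sigma> (vertex_perm_map n v ?\<tau> x) = x"
    by (simp add: bary_coords_combination)
qed

text \<open>Membership in the simplex means nonnegative coordinates, a condition that does not
  change when the coordinates are permuted.\<close>

lemma vertex_perm_map_vimage_simplex:
  assumes \<sigma>: "bij_betw \<sigma> {0..n} {0..n}"
  shows "vertex_perm_map n v \<sigma> -` (convex hull (v ` {0..n})) = convex hull (v ` {0..n})"
proof -
  have "(\<forall>j\<in>{0..n}. 0 \<le> bary_coords n v x (\<sigma> j)) \<longleftrightarrow> (\<forall>i\<in>{0..n}. 0 \<le> bary_coords n v x i)" for x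
  proof -
    have "(\<forall>j\<in>{0..n}. 0 \<le> bary_coords n v x (\<sigma> j)) \<longleftrightarrow> (\<forall>i\<in>\<sigma> ` {0..n}. 0 \<le> bary_coords n v x i)"
      by blast
    then show ?thesis by (simp only: bij_betw_imp_surj_on[OF \<sigma>])
  qed
  then show ?thesis
    by (auto simp: mem_simplex_iff_bary_coords bary_coords_vertex_perm_map[OF \<sigma>] Ball_def)
qed

lemma emeasure_simplex_nonzero: "emeasure lborel (convex hull (v ` {0..n})) \<noteq> 0"
proof
  let ?S = "convex hull (v ` {0..n})"
  assume 0: "emeasure lborel ?S = 0"
  have "card (v ` {0..n}) = Suc DIM('a)" using card_image[OF inj] dim by simp
  then have "interior ?S \<noteq> {}" using interior_convex_hull_eq_empty indep by blast
  moreover have "?S \<in> sets borel"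
    by (intro borel_compact compact_convex_hull finite_imp_compact) simp
  then have "negligible ?S"
    using 0 by (simp add: negligible_iff_null_sets null_sets_def)
  ultimately show False using negligible_convex_interior[OF convex_convex_hull] by blast
qed

lemma vertex_perm_map_vertex:
  assumes \<sigma>: "bij_betw \<sigma> {0..n} {0..n}" and i: "i \<le> n"
  shows "vertex_perm_map n v \<sigma> (v (\<sigma> i)) = v i"
proof -
  have \<sigma>i: "\<sigma> i \<le> n" using bij_betwE[OF \<sigma>] i by auto
  have c: "bary_coords n v (v (\<sigma> i)) j = (if j = \<sigma> i then 1 else 0)" if "j \<le> n" for j
    using that \<sigma>i by (intro bary_coords_eqI[of "\<lambda>j. if j = \<sigma> i then 1 else 0"])
      (simp_all add: if_distrib[of "\<lambda>r. r *\<^sub>R _"] cong: if_cong)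
  have "vertex_perm_map n v \<sigma> (v (\<sigma> i)) = (\<Sum>j=0..n. (if j = i then v j else 0))"
    unfolding vertex_perm_map_def
  proof (intro sum.cong refl)
    fix j assume j: "j \<in> {0..n}"
    then have "\<sigma> j \<le> n" "\<sigma> j = \<sigma> i \<longleftrightarrow> j = i"
      using \<sigma> i by (auto simp: bij_betw_def inj_on_def)
    then show "bary_coords n v (v (\<sigma> i)) (\<sigma> j) *\<^sub>R v j = (if j = i then v j else 0)"
      by (simp add: c)
  qed
  then show ?thesis using i by simp
qed

text \<open>The shift by \<open>k\<close> sends the vertex with index \<open>j\<close> to the one with index \<open>j - k\<close> modulo \<open>n + 1\<close>.
  For fixed \<open>j\<close> this index runs through all of \<open>{0..n}\<close>, because \<open>k \<mapsto> j - k\<close> is an involution.\<close>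

lemma sum_vertex_perm_map_vertex:
  assumes "j \<le> n"
  shows "(\<Sum>\<sigma>\<in>cyclic_perms n. h (vertex_perm_map n v \<sigma> (v j))) = (\<Sum>i=0..n. h (v i))"
proof -
  define r where "r = (\<lambda>k. (j + (n + 1 - k)) mod (n + 1))"
  have r_le: "r k \<le> n" for k
    unfolding r_def using mod_less_divisor[of "n + 1"] by (simp add: less_Suc_eq_le)
  have r_shift: "(r k + k) mod (n + 1) = j" if "k \<le> n" for k
    unfolding r_def by (rule cyclic_shift_inverse(2)[OF that assms])
  have invol: "r (r k) = k" if "k \<le> n" for k
  proof -
    have "(r (r k) + r k) mod (n + 1) = (k + r k) mod (n + 1)"
      using r_shift[OF r_le] r_shift[OF that] by (simp add: add.commute)
    then have "inj_on (\<lambda>i. (i + r k) mod (n + 1)) {0..n} \<Longrightarrow> r (r k) = k"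
      using r_le that by (auto dest: inj_onD)
    then show ?thesis using bij_betw_imp_inj_on[OF bij_betw_cyclic_shift[OF r_le]] by blast
  qed
  have bij: "bij_betw r {0..n} {0..n}"
    by (rule bij_betw_byWitness[where f' = r]) (auto simp: invol r_le)
  have "vertex_perm_map n v (\<lambda>i. (i + k) mod (n + 1)) (v j) = v (r k)" if "k \<le> n" for k
    using vertex_perm_map_vertex[OF bij_betw_cyclic_shift[OF that] r_le] r_shift[OF that] by metis
  then have "(\<Sum>\<sigma>\<in>cyclic_perms n. h (vertex_perm_map n v \<sigma> (v j))) = (\<Sum>k=0..n. h (v (r k)))"
    unfolding sum_over_cyclic_perms by (intro sum.cong) auto
  also have "\<dots> = (\<Sum>i=0..n. h (v i))"
    by (rule sum.reindex_bij_betw[OF bij])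
  finally show ?thesis .
qed

text \<open>Each vertex receives every barycentric coordinate of \<open>x\<close> exactly once, hence total weight 1.\<close>

lemma sum_vertex_perm_map:
  "(\<Sum>\<sigma>\<in>cyclic_perms n. vertex_perm_map n v \<sigma> x) = real (n + 1) *\<^sub>R barycenter n v"
proof -
  have "(\<Sum>\<sigma>\<in>cyclic_perms n. vertex_perm_map n v \<sigma> x)
      = (\<Sum>i=0..n. (\<Sum>\<sigma>\<in>cyclic_perms n. bary_coords n v x (\<sigma> i)) *\<^sub>R v i)"
    unfolding vertex_perm_map_def by (subst sum.swap) (simp add: scaleR_sum_left)
  also have "\<dots> = (\<Sum>i=0..n. v i)"
    by (intro sum.cong) (simp_all add: sum_cyclic_perms_orbit sum_bary_coords)
  finally show ?thesis by (simp add: barycenter_def)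
qed

section \<open>Symmetrization over the cyclic shifts\<close>

text \<open>The lower bound is Jensen's inequality for the points \<open>\<sigma> x\<close>, whose mean is the barycenter.  It
  makes \<open>G\<close> convex although \<open>g\<close> itself may be neither convex nor measurable; the upper bound is then the
  maximum principle for convex functions, \<open>G\<close> taking the same value at all vertices.\<close>

lemma cyclic_symmetrization_Wright_convex:
  fixes g :: "'a \<Rightarrow> real"
  assumes D: "open D" "convex D" "convex hull (v ` {0..n}) \<subseteq> D" and g: "strongly_W_convex_on D 0 g"
  defines "G \<equiv> \<lambda>x. \<Sum>\<sigma>\<in>cyclic_perms n. g (vertex_perm_map n v \<sigma> x)"
  shows "continuous_on (convex hull (v ` {0..n})) G"
    and "x \<in> convex hull (v ` {0..n}) \<Longrightarrow> real (n + 1) * g (barycenter n v) \<le> G x"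
    and "x \<in> convex hull (v ` {0..n}) \<Longrightarrow> G x \<le> (\<Sum>i=0..n. g (v i))"
proof -
  let ?S = "convex hull (v ` {0..n})"
  define T where "T = vertex_perm_map n v"
  define C where "C = cyclic_perms n"
  have fin: "finite C" by (simp add: C_def cyclic_perms_def)
  have aff: "affine_map (T \<sigma>)" if "\<sigma> \<in> C" for \<sigma>
    using affine_map_vertex_perm_map bij_betw_cyclic_perm[of \<sigma> n] that
    by (simp add: T_def C_def bij_betw_def)
  have T_S: "T \<sigma> -` ?S = ?S" if "\<sigma> \<in> C" for \<sigma>
    using vertex_perm_map_vimage_simplex bij_betw_cyclic_perm[of \<sigma> n] that by (simp add: T_def C_def)
  have T_flip: "T \<sigma> ((1 - t) *\<^sub>R x + t *\<^sub>R y) = (1 - t) *\<^sub>R T \<sigma> x + t *\<^sub>R T \<sigma> y"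
    if "\<sigma> \<in> C" for \<sigma> t x y
    using affine_map_comb[OF aff[OF that], of "1 - t" x y] by simp
  have G: "G = (\<lambda>x. \<Sum>\<sigma>\<in>C. g (T \<sigma> x))" by (simp add: G_def T_def C_def)
  \<comment> \<open>On this open set around the simplex \<open>G\<close> depends only on the values of \<open>g\<close> on \<open>D\<close>.  Convexity on
    the simplex alone would not give continuity at its boundary.\<close>
  define E where "E = {x. \<forall>\<sigma>\<in>C. T \<sigma> x \<in> D}"
  have "convex E"
    using T_flip convexD_alt[OF D(2)] by (auto simp: E_def convex_alt)
  have "open E"
  proof -
    have "E = (\<Inter>\<sigma>\<in>C. T \<sigma> -` D)" by (auto simp: E_def)
    moreover have "open (T \<sigma> -` D)" if "\<sigma> \<in> C" for \<sigma>
      using affine_map_continuous_on[OF aff[OF that], of UNIV] D(1)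
      by (simp add: open_vimage)
    ultimately show ?thesis using fin by (simp add: open_INT)
  qed
  have "?S \<subseteq> E" using T_S D(3) by (auto simp: E_def)
  have G_Wright: "strongly_W_convex_on E 0 G"
    unfolding strongly_W_convex_on_def
  proof (intro ballI)
    fix x y and t :: real
    assume x: "x \<in> E" and y: "y \<in> E" and t: "t \<in> {0..1}"
    have "(\<Sum>\<sigma>\<in>C. g (T \<sigma> (t *\<^sub>R x + (1 - t) *\<^sub>R y)) + g (T \<sigma> ((1 - t) *\<^sub>R x + t *\<^sub>R y)))
        \<le> (\<Sum>\<sigma>\<in>C. g (T \<sigma> x) + g (T \<sigma> y))"
      using x y t Wright_convex_on_pair[OF g]
      by (intro sum_mono) (simp add: E_def T_flip affine_map_comb[OF aff])
    then show "G (t *\<^sub>R x + (1 - t) *\<^sub>R y) + G ((1 - t) *\<^sub>R x + t *\<^sub>R y)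
        \<le> G x + G y - 2 * 0 * t * (1 - t) * (norm (x - y))\<^sup>2"
      by (simp add: G sum.distrib)
  qed
  have lower: "real (n + 1) * g (barycenter n v) \<le> G x" if "x \<in> E" for x
  proof -
    define y where "y = (\<lambda>k. T (\<lambda>i. (i + k) mod (n + 1)) x)"
    have as_range: "(\<Sum>\<sigma>\<in>C. h (T \<sigma> x)) = (\<Sum>k<n+1. h (y k))" for h :: "'a \<Rightarrow> 'c::comm_monoid_add"
      unfolding C_def sum_over_cyclic_perms y_def
      by (intro sum.cong) auto
    have "y k \<in> D" if "k < n + 1" for k
      using \<open>x \<in> E\<close> that by (auto simp: y_def E_def C_def cyclic_perms_def)
    then have "real (n + 1) * g ((1 / real (n + 1)) *\<^sub>R (\<Sum>k<n+1. y k)) \<le> (\<Sum>k<n+1. g (y k))"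
      by (intro Wright_convex_on_mean[OF g D(2)]) auto
    moreover have "(\<Sum>k<n+1. y k) = real (n + 1) *\<^sub>R barycenter n v"
      using as_range[of "\<lambda>z. z"] sum_vertex_perm_map[of x]
      by (simp only: T_def C_def)
    then have "(1 / real (n + 1)) *\<^sub>R (\<Sum>k<n+1. y k) = barycenter n v"
      by (simp only: scaleR_scaleR) simp
    ultimately show ?thesis by (simp only: G as_range)
  qed
  have G_convex: "convex_on E G"
    by (rule Wright_convex_on_bounded_below_imp_convex_on[OF G_Wright \<open>convex E\<close> lower])
  have G_cont: "continuous_on ?S G"
    using convex_on_continuous[OF \<open>open E\<close> G_convex] \<open>?S \<subseteq> E\<close> continuous_on_subset by blast
  have upper: "G x \<le> (\<Sum>i=0..n. g (v i))" if "x \<in> ?S" for x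
  proof -
    have "convex_on ?S G"
      using G_convex \<open>?S \<subseteq> E\<close> by (rule convex_on_subset) simp
    moreover have "G (v j) = (\<Sum>i=0..n. g (v i))" if "j \<le> n" for j
      unfolding G T_def C_def by (rule sum_vertex_perm_map_vertex[OF that])
    ultimately show ?thesis
      using convex_on_convex_hull_bound[of "v ` {0..n}" G] that by auto
  qed
  show "continuous_on ?S G" by (rule G_cont)
  show "real (n + 1) * g (barycenter n v) \<le> G x" if "x \<in> ?S"
    using lower that \<open>?S \<subseteq> E\<close> by blast
  show "G x \<le> (\<Sum>i=0..n. g (v i))" if "x \<in> ?S"
    using upper that by blast
qed

lemma integral_simplex_vertex_perm_map:
  fixes q :: "'a \<Rightarrow> real"
  assumes \<sigma>: "bij_betw \<sigma> {0..n} {0..n}" and q: "q \<in> borel_measurable borel"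
  shows "(LINT x:convex hull (v ` {0..n})|lborel. q (vertex_perm_map n v \<sigma> x))
    = (LINT x:convex hull (v ` {0..n})|lborel. q x)"
  using bij_betw_imp_surj_on[OF \<sigma>] surj_vertex_perm_map[OF \<sigma>] vertex_perm_map_vimage_simplex[OF \<sigma>]
  by (intro integral_lborel_affine_invariant_set affine_map_vertex_perm_map q
      compact_convex_hull finite_imp_compact emeasure_simplex_nonzero) simp_all

end

section \<open>The Hermite--Hadamard inequality\<close>

theorem corollary12:
  fixes D S :: "(real ^ 'n) set" and v :: "nat \<Rightarrow> real ^ 'n"
    and f :: "real ^ 'n \<Rightarrow> real" and c :: real and n :: nat
  assumes n: "n = CARD('n)"
    and "open D" and "convex D"
    and "simplex_with_vertices n v S" and "S \<subseteq> D"
    and "c > 0"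
    and "strongly_W_convex_on D c f"
  shows "set_integrable lebesgue S (\<lambda>x. \<Sum>\<sigma>\<in>cyclic_perms n. f (vertex_perm_map n v \<sigma> x)) \<and>
    f (barycenter n v)
        + c * ((1 / measure lebesgue S) * (LINT x:S|lebesgue. (norm x)\<^sup>2) - (norm (barycenter n v))\<^sup>2)
      \<le> (1 / (real (n + 1) * measure lebesgue S))
          * (LINT x:S|lebesgue. (\<Sum>\<sigma>\<in>cyclic_perms n. f (vertex_perm_map n v \<sigma> x))) \<and>
    (1 / (real (n + 1) * measure lebesgue S))
          * (LINT x:S|lebesgue. (\<Sum>\<sigma>\<in>cyclic_perms n. f (vertex_perm_map n v \<sigma> x)))
      \<le> (1 / real (n + 1)) * (\<Sum>i=0..n. f (v i))
        + c * ((1 / measure lebesgue S) * (LINT x:S|lebesgue. (norm x)\<^sup>2)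
               - (1 / real (n + 1)) * (\<Sum>i=0..n. (norm (v i))\<^sup>2))"
proof -
  define T where "T = vertex_perm_map n v"
  define C where "C = cyclic_perms n"
  define b where "b = barycenter n v"
  define q where "q = (\<lambda>x :: real ^ 'n. (norm x)\<^sup>2)"
  define g where "g = (\<lambda>x. f x - c * q x)"
  define G where "G = (\<lambda>x. \<Sum>\<sigma>\<in>C. g (T \<sigma> x))"
  define Q where "Q = (\<lambda>x. \<Sum>\<sigma>\<in>C. q (T \<sigma> x))"
  have inj: "inj_on v {0..n}" and indep: "\<not> affine_dependent (v ` {0..n})"
    and S: "S = convex hull (v ` {0..n})"
    using assms(4) by (simp_all add: simplex_with_vertices_def)
  have dim: "n = DIM(real ^ 'n)" using n by simp
  note simplex = inj indep dim
  have cardC: "card C = n + 1"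
    using sum_over_cyclic_perms[of "\<lambda>_. 1::nat" n] by (simp add: C_def)
  have bij: "bij_betw \<sigma> {0..n} {0..n}" if "\<sigma> \<in> C" for \<sigma>
    using that bij_betw_cyclic_perm by (simp add: C_def)
  have aff: "affine_map (T \<sigma>)" if "\<sigma> \<in> C" for \<sigma>
    using affine_map_vertex_perm_map[OF simplex] bij[OF that] by (simp add: T_def bij_betw_def)
  have g: "strongly_W_convex_on D 0 g"
    using assms(7) unfolding strongly_W_convex_on_iff_minus_square[of D c f] g_def q_def .
  have hull_D: "convex hull (v ` {0..n}) \<subseteq> D" using assms(5) S by simp
  note sym = cyclic_symmetrization_Wright_convex[OF simplex assms(2,3) hull_D g]
  have G_cont: "continuous_on S G"
    using sym(1) by (simp only: S G_def T_def C_def)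
  have lower: "real (n + 1) * g b \<le> G x" if "x \<in> S" for x
    using sym(2) that by (simp only: S G_def T_def C_def b_def)
  have upper: "G x \<le> (\<Sum>i=0..n. g (v i))" if "x \<in> S" for x
    using sym(3) that by (simp only: S G_def T_def C_def)

  have S_compact: "compact S"
    unfolding S by (intro compact_convex_hull finite_imp_compact) simp
  then have S_meas: "S \<in> sets borel" by (rule borel_compact)
  have S_finite: "emeasure lborel S \<noteq> \<infinity>"
    using emeasure_compact_finite[OF S_compact] by auto
  have S_pos: "emeasure lborel S \<noteq> 0"
    unfolding S by (rule emeasure_simplex_nonzero[OF simplex])
  define m where "m = measure lborel S"
  have m: "0 < m" "measure lebesgue S = m"
    using S_pos S_finite S_meas
    by (auto simp: m_def measure_def enn2real_positive_iff less_top zero_less_iff_neq_zero)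
  have integrable: "set_integrable lborel S h" if "continuous_on S h" for h :: "real ^ 'n \<Rightarrow> real"
    using borel_integrable_compact[OF S_compact that] by (simp add: set_integrable_def)
  \<comment> \<open>All integrands are continuous on the compact set \<open>S\<close>, so Borel and Lebesgue integrals agree.\<close>
  have to_lborel: "set_integrable lebesgue S h \<and> (LINT x:S|lebesgue. h x) = (LINT x:S|lborel. h x)"
    if "continuous_on S h" for h :: "real ^ 'n \<Rightarrow> real"
  proof -
    have "(\<lambda>x. indicator S x *\<^sub>R h x) \<in> borel_measurable lborel"
      using integrable[OF that] by (simp add: set_integrable_def borel_measurable_integrable)
    with integrable[OF that] show ?thesis
      by (simp add: set_integrable_def set_lebesgue_integral_def integrable_completion integral_completion)
  qed
  have q_cont: "continuous_on A q" for A unfolding q_def by (intro continuous_intros)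
  have qT_cont: "continuous_on S (\<lambda>x. q (T \<sigma> x))" if "\<sigma> \<in> C" for \<sigma>
    by (rule continuous_on_compose2[OF q_cont[of UNIV] affine_map_continuous_on[OF aff[OF that]]]) simp
  have Q_cont: "continuous_on S Q" unfolding Q_def using qT_cont by (intro continuous_on_sum)
  have f_sum: "(\<Sum>\<sigma>\<in>C. f (T \<sigma> x)) = G x + c * Q x" for x
    by (simp add: G_def Q_def g_def sum_subtractf sum_distrib_left)
  then have f_cont: "continuous_on S (\<lambda>x. \<Sum>\<sigma>\<in>C. f (T \<sigma> x))"
    using G_cont Q_cont by (simp add: continuous_intros)

  have "(LINT x:S|lborel. Q x) = (\<Sum>\<sigma>\<in>C. LINT x:S|lborel. q (T \<sigma> x))"
    using integrable[OF qT_cont]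
    by (simp add: Q_def set_integrable_def set_lebesgue_integral_def sum_distrib_left
        Bochner_Integration.integral_sum)
  also have "\<dots> = (\<Sum>\<sigma>\<in>C. LINT x:S|lborel. q x)"
  proof (rule sum.cong)
    fix \<sigma> assume "\<sigma> \<in> C"
    then show "(LINT x:S|lborel. q (T \<sigma> x)) = (LINT x:S|lborel. q x)"
      using integral_simplex_vertex_perm_map[OF simplex bij borel_measurable_continuous_onI[OF q_cont]]
      by (simp add: S T_def)
  qed simp
  also have "\<dots> = real (n + 1) * (LINT x:S|lborel. q x)" by (simp add: cardC)
  finally have Q_int: "(LINT x:S|lborel. Q x) = real (n + 1) * (LINT x:S|lborel. q x)" .
  have f_int: "(LINT x:S|lborel. (\<Sum>\<sigma>\<in>C. f (T \<sigma> x)))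
      = (LINT x:S|lborel. G x) + c * (real (n + 1) * (LINT x:S|lborel. q x))"
    using set_integral_add(2)[OF integrable[OF G_cont], of "\<lambda>x. c * Q x"]
      integrable[of "\<lambda>x. c * Q x"] Q_cont Q_int
    by (simp add: f_sum continuous_intros)
  have const_int: "(LINT x:S|lborel. r) = m * r" for r :: real
    using set_integral_const[of S lborel r] S_meas S_finite by (simp add: m_def)
  have G_int_lower: "m * (real (n + 1) * g b) \<le> (LINT x:S|lborel. G x)"
    unfolding const_int[symmetric] using lower
    by (intro set_integral_mono integrable G_cont continuous_on_const) auto
  have G_int_upper: "(LINT x:S|lborel. G x) \<le> m * (\<Sum>i=0..n. g (v i))"
    unfolding const_int[symmetric] using upper
    by (intro set_integral_mono integrable G_cont continuous_on_const)
  have cancel: "(1 / (N * m)) * (X + c * (N * Y)) = (1 / (N * m)) * X + c * ((1 / m) * Y)"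
    if "0 < N" for N X Y :: real
    using that m(1) by (simp add: field_simps)
  have mean: "(1 / (real (n + 1) * m)) * (LINT x:S|lborel. (\<Sum>\<sigma>\<in>C. f (T \<sigma> x)))
      = (1 / (real (n + 1) * m)) * (LINT x:S|lborel. G x) + c * ((1 / m) * (LINT x:S|lborel. q x))"
    unfolding f_int by (rule cancel) simp
  have "f b + c * ((1 / m) * (LINT x:S|lborel. q x) - q b)
      = (1 / (real (n + 1) * m)) * (m * (real (n + 1) * g b)) + c * ((1 / m) * (LINT x:S|lborel. q x))"
    using m(1) unfolding g_def by (simp add: right_diff_distrib del: of_nat_add)
  also have "\<dots> \<le> (1 / (real (n + 1) * m)) * (LINT x:S|lborel. (\<Sum>\<sigma>\<in>C. f (T \<sigma> x)))"
    unfolding mean using G_int_lower m(1) by (intro add_right_mono mult_left_mono) auto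
  finally have left: "f b + c * ((1 / m) * (LINT x:S|lborel. q x) - q b)
      \<le> (1 / (real (n + 1) * m)) * (LINT x:S|lborel. (\<Sum>\<sigma>\<in>C. f (T \<sigma> x)))" .
  have "(1 / (real (n + 1) * m)) * (LINT x:S|lborel. (\<Sum>\<sigma>\<in>C. f (T \<sigma> x)))
      \<le> (1 / (real (n + 1) * m)) * (m * (\<Sum>i=0..n. g (v i))) + c * ((1 / m) * (LINT x:S|lborel. q x))"
    unfolding mean using G_int_upper m(1) by (intro add_right_mono mult_left_mono) auto
  also have "\<dots> = (1 / real (n + 1)) * (\<Sum>i=0..n. g (v i)) + c * ((1 / m) * (LINT x:S|lborel. q x))"
    using m(1) by simp
  also have "\<dots> = (1 / real (n + 1)) * (\<Sum>i=0..n. f (v i))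
      + c * ((1 / m) * (LINT x:S|lborel. q x) - (1 / real (n + 1)) * (\<Sum>i=0..n. q (v i)))"
    unfolding g_def sum_subtractf sum_distrib_left[symmetric] right_diff_distrib by simp
  finally have right: "(1 / (real (n + 1) * m)) * (LINT x:S|lborel. (\<Sum>\<sigma>\<in>C. f (T \<sigma> x)))
      \<le> (1 / real (n + 1)) * (\<Sum>i=0..n. f (v i))
        + c * ((1 / m) * (LINT x:S|lborel. q x) - (1 / real (n + 1)) * (\<Sum>i=0..n. q (v i)))" .
  have "set_integrable lebesgue S (\<lambda>x. \<Sum>\<sigma>\<in>C. f (T \<sigma> x))"
    using to_lborel[OF f_cont] by blast
  moreover note left right
  ultimately show ?thesis
    using to_lborel[OF f_cont] to_lborel[OF q_cont] m(2)
    unfolding T_def C_def b_def q_def by simp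
qed

end
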